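(* Let $S$ be a transcendental semigroup. If $K(S)\neq\emptyset$, then $K(S)$ is $S$-completely invariant, i.e. completely invariant under each $f\in S$, and $K(S)$ contains all points $z\in\mathbb{C}$ such that $f^n(z)\to\infty$ as $n\to\infty$ for every $f\in S$.
   Context: A transcendental semigroup $S=\langle f_1,f_2,\ldots\rangle$ is the semigroup, under functional composition, generated by a set $\{f_i : i\in\mathbb{N}\}$ of transcendental entire functions $f_i:\mathbb{C}\to\mathbb{C}$ (possibly finitely many); $f^n$ denotes the $n$-th iterate of $f$. A set $U\subset\mathbb{C}$ is completely invariant under $f$ if $f(U)\subset U$ and $f^{-1}(U)\subset U$; it is $S$-completely invariant if this holds for all $f\in S$. The completely invariant escaping set of $S$ is defined as $$K(S)=\bigcap_{i\in\mathbb{N}}\{E_i : E_i \text{ is completely invariant under each } f\in S \text{ and each } E_i \text{ contains points } z\in\mathbb{C} \text{ such that } f^n(z)\to\infty \text{ as } n\to\infty \text{ for every } f\in S\},$$ that is, $K(S)=\bigcap_{i\in\mathbb{N}}E_i$ where the $E_i$ are the sets just described. *)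

theory Defs
  imports "HOL-Analysis.Analysis" "HOL-Computational_Algebra.Polynomial"
begin

definition transcendental_entire :: "(complex \<Rightarrow> complex) \<Rightarrow> bool" where
  "transcendental_entire f \<longleftrightarrow> f holomorphic_on UNIV \<and> \<not> (\<exists>p :: complex poly. f = poly p)"

inductive_set comp_semigroup :: "('a \<Rightarrow> 'a) set \<Rightarrow> ('a \<Rightarrow> 'a) set"
  for G :: "('a \<Rightarrow> 'a) set" where
  generator: "g \<in> G \<Longrightarrow> g \<in> comp_semigroup G"
| composition: "f \<in> comp_semigroup G \<Longrightarrow> g \<in> comp_semigroup G \<Longrightarrow> f \<circ> g \<in> comp_semigroup G"

text \<open>The generating sequence need not be injective, so finitely generated semigroups are included.\<close>

definition transcendental_semigroup :: "(complex \<Rightarrow> complex) set \<Rightarrow> bool" where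
  "transcendental_semigroup S \<longleftrightarrow>
     (\<exists>f :: nat \<Rightarrow> complex \<Rightarrow> complex.
        (\<forall>i. transcendental_entire (f i)) \<and> S = comp_semigroup (range f))"

definition completely_invariant :: "('a \<Rightarrow> 'a) \<Rightarrow> 'a set \<Rightarrow> bool" where
  "completely_invariant f U \<longleftrightarrow> f ` U \<subseteq> U \<and> f -` U \<subseteq> U"

definition S_completely_invariant :: "('a \<Rightarrow> 'a) set \<Rightarrow> 'a set \<Rightarrow> bool" where
  "S_completely_invariant S U \<longleftrightarrow> (\<forall>f\<in>S. completely_invariant f U)"

definition escapes_under :: "(complex \<Rightarrow> complex) \<Rightarrow> complex \<Rightarrow> bool" where
  "escapes_under f z \<longleftrightarrow> filterlim (\<lambda>n. (f ^^ n) z) at_infinity sequentially"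

text \<open>
  The intersection ranges over all completely invariant sets that contain some point escaping under
  every element of the semigroup, not over a chosen countable family of them. If there is no
  such set, the intersection is the whole plane.
\<close>

definition completely_invariant_escaping_set :: "(complex \<Rightarrow> complex) set \<Rightarrow> complex set" where
  "completely_invariant_escaping_set S =
     \<Inter>{E. S_completely_invariant S E \<and> (\<exists>z\<in>E. \<forall>f\<in>S. escapes_under f z)}"

end

theory Submission
  imports Defs
begin

text \<open>
  Complete invariance under a family of maps says that membership does not change along any of
  the maps, so the completely invariant sets are closed under arbitrary intersections and under
  complements. Closure under intersections makes \<open>K(S)\<close> completely invariant. Closure under
  complements gives the rest: if a point that escapes under every element of \<open>S\<close> lay outside one
  of the sets \<open>E\<close> being intersected, then the complement of \<open>E\<close> would also be one of these sets,
  and \<open>K(S)\<close> would be contained in both \<open>E\<close> and its complement, hence empty.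
\<close>

lemma S_completely_invariant_iff_mem:
  "S_completely_invariant S U \<longleftrightarrow> (\<forall>f\<in>S. \<forall>z. f z \<in> U \<longleftrightarrow> z \<in> U)"
  unfolding S_completely_invariant_def completely_invariant_def by blast

lemma S_completely_invariant_Inter:
  "(\<And>E. E \<in> \<E> \<Longrightarrow> S_completely_invariant S E) \<Longrightarrow> S_completely_invariant S (\<Inter>\<E>)"
  by (simp add: S_completely_invariant_iff_mem)

lemma S_completely_invariant_Compl:
  "S_completely_invariant S E \<Longrightarrow> S_completely_invariant S (- E)"
  by (simp add: S_completely_invariant_iff_mem)

theorem proposition3p1:
  fixes S :: "(complex \<Rightarrow> complex) set"
  assumes "transcendental_semigroup S"
    and "completely_invariant_escaping_set S \<noteq> {}"
  shows "S_completely_invariant S (completely_invariant_escaping_set S) \<and>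
    (\<forall>z. (\<forall>f\<in>S. escapes_under f z) \<longrightarrow> z \<in> completely_invariant_escaping_set S)"
proof (intro conjI allI impI)
  show "S_completely_invariant S (completely_invariant_escaping_set S)"
    unfolding completely_invariant_escaping_set_def
    by (rule S_completely_invariant_Inter) simp
next
  fix z
  assume escapes: "\<forall>f\<in>S. escapes_under f z"
  have "z \<in> E"
    if inv: "S_completely_invariant S E" and esc: "\<exists>w\<in>E. \<forall>f\<in>S. escapes_under f w" for E
  proof (rule ccontr)
    assume "z \<notin> E"
    with escapes have "\<exists>w\<in>- E. \<forall>f\<in>S. escapes_under f w" by blast
    with S_completely_invariant_Compl[OF inv]
    have "completely_invariant_escaping_set S \<subseteq> - E"
      unfolding completely_invariant_escaping_set_def by blast
    moreover have "completely_invariant_escaping_set S \<subseteq> E"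
      using inv esc unfolding completely_invariant_escaping_set_def by blast
    ultimately show False using assms(2) by blast
  qed
  then show "z \<in> completely_invariant_escaping_set S"
    unfolding completely_invariant_escaping_set_def by blast
qed

end
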